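(* We have $$\sum_{k=1}^\infty \frac{256^k \big( (22k-1) H_{2k-1} +15 \frac{6k-1}{2k-1} \big)}{(2k-1) k^2 \binom{3k}{k} \binom{6k}{3k}}= 16 \pi^3$$ and $$\sum_{k=1}^\infty \frac{256^k \big( (22k-1) (2H_{6k-1} - H_{3k-1} +H_{k-1}) + \frac{268k-38}{2k-1} \big)}{(2k-1) k^2 \binom{3k}{k} \binom{6k}{3k}}= 48 \pi^3.$$ Consequently, we have $$\sum_{k=1}^\infty \frac{256^k \big( (22k-1)\mathcal H(k)-50 \big)}{(2k-1) k^2 \binom{3k}{k} \binom{6k}{3k}}= -16 \pi^3,$$ where $\mathcal H(k) = 10H_{6k-1}-5H_{3k-1}-16H_{2k-1}+5H_{k-1}$. Moreover, we have $$\sum_{k=1}^\infty \frac{256^k \big( (22k-1) H_{2k-1}^{(2)} - 29 \frac{6k-1}{(2k-1)^2} \big)}{(2k-1) k^2 \binom{3k}{k} \binom{6k}{3k}}= -512 \beta(4),$$ where $\beta(4) = \sum_{k=0}^\infty \frac{(-1)^k}{(2k+1)^4}$.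
   Context: For integers $m\ge1$ and $n\ge0$, $H_n^{(m)}=\sum_{0<j\le n}\frac1{j^m}$ denotes the harmonic number of order $m$, and $H_n=H_n^{(1)}$ (so $H_0=H_0^{(m)}=0$). *)

theory Defs
  imports "HOL-Analysis.Analysis"
begin

definition gen_harm :: "nat \<Rightarrow> nat \<Rightarrow> real" where
  "gen_harm m n = (\<Sum>j=1..n. 1 / real j ^ m)"

text \<open>The library's \<^const>\<open>harm\<close> is the case of order 1.\<close>

lemma gen_harm_1: "gen_harm 1 n = harm n"
  by (simp add: gen_harm_def harm_def inverse_eq_divide)

text \<open>Only meaningful for \<open>s \<ge> 1\<close>, where the alternating series converges.\<close>

definition dirichlet_beta :: "nat \<Rightarrow> real" where
  "dirichlet_beta s = (\<Sum>k. (-1) ^ k / (2 * real k + 1) ^ s)"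

definition calH :: "nat \<Rightarrow> real" where
  "calH k = 10 * harm (6*k - 1) - 5 * harm (3*k - 1) - 16 * harm (2*k - 1) + 5 * harm (k - 1)"

text \<open>
  \<open>a sums_from_1 s\<close> says that the series of \<open>a k\<close> over \<open>k = 1, 2, 3, \<dots>\<close> converges to \<open>s\<close>
  in the usual sense of partial sums. The value \<open>a 0\<close> is irrelevant, so the truncated natural
  number subtractions \<open>2*k - 1\<close>, \<open>k - 1\<close>, and so on in the indices of harmonic numbers are exact.
\<close>

definition sums_from_1 :: "(nat \<Rightarrow> real) \<Rightarrow> real \<Rightarrow> bool" (infix "sums'_from'_1" 80) where
  "a sums_from_1 s \<longleftrightarrow> (\<lambda>n. a (Suc n)) sums s"

end

theory Submission
  imports Defs "HOL-Real_Asymp.Real_Asymp"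
begin

text \<open>
  All the series are accelerations of alternating sums over half-integers \<open>s = m + 1/2\<close>, obtained by one
  telescoping argument. Put \<open>K\<^sub>N(s) = \<Prod>i=1..N. i\<^sup>2 / (i\<^sup>2 - s\<^sup>2)\<close>. The difference of \<open>K\<^sub>N\<^sub>-\<^sub>1(s) / s\<^sup>2\<close> and
  \<open>K\<^sub>N(s) / s\<^sup>2\<close> is a multiple of \<open>1 / ((s\<^sup>2 - 1\<^sup>2) \<dots> (s\<^sup>2 - N\<^sup>2))\<close>, and with the sign \<open>(-1)\<^sup>m\<close> this
  telescopes in \<open>m\<close>. Hence the tail sums of \<open>(-1)\<^sup>m K\<^sub>2\<^sub>n(s) / s\<^sup>2\<close> over \<open>m \<ge> n\<close> differ from one \<open>n\<close> to the
  next by an explicit term, and they tend to 0 geometrically, with ratio \<open>16/27\<close>.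
  Along the diagonal \<open>m = n\<close> the kernel is a quotient of factorials, and the explicit term becomes
  \<open>(22 k - 1) * 256\<^sup>k / (32 (2 k - 1) k\<^sup>2 binom(3k,k) binom(6k,3k))\<close> with \<open>k = n + 1\<close>.

  The harmonic numbers enter because the kernel can be deformed. Its linear factors \<open>s - i\<close> and \<open>s + i\<close> may be
  shifted independently, and there is also an even deformation in which \<open>1 / s\<^sup>2\<close> becomes
  \<open>1 / (s\<^sup>2 - x\<^sup>2)\<close>. The first derivatives, or the coefficient of \<open>x\<^sup>2\<close>, of the deformed identities
  multiply the kernel by a weight \<open>W\<close> and the boundary terms by a weight \<open>V\<close>. Only a linear equation between
  \<open>W\<close> and \<open>V\<close> is required for the telescoping (\<open>weighted_acceleration\<close>), so that no infinite sum is
  differentiated.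

  Shifting the factors \<open>s - i\<close> gives the first series, and its value is a multiple of
  \<open>\<beta>(3) = \<pi>\<^sup>3 / 32\<close>. Shifting the factors \<open>s + i\<close> is the same with \<open>s\<close> replaced by \<open>- s\<close>; it gives a
  series (\<open>series_odd_harm\<close>) that yields the second one by a linear combination with the first. The third is a
  combination of these two. The even deformation gives the last series, with value a multiple of \<open>\<beta>(4)\<close>.
\<close>

section \<open>Dirichlet beta values\<close>

text \<open>
  The reflection formula \<open>\<Gamma>(x) \<Gamma>(1 - x) = \<pi> / sin (\<pi> x)\<close> is differentiated logarithmically three
  times. The third derivative at \<open>x = 1/4\<close> compares the sums of \<open>1 / (4 k + 1)\<^sup>3\<close> and
  \<open>1 / (4 k + 3)\<^sup>3\<close>, which are the two halves of \<open>\<beta>(3)\<close>.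
\<close>

lemma ln_Gamma_reflection:
  assumes "0 < x" "x < (1::real)"
  shows "ln_Gamma x + ln_Gamma (1 - x) = ln pi - ln (sin (pi * x))"
proof -
  have "sin (pi * x) > 0"
    using assms by (intro sin_gt_zero) auto
  have "Gamma (complex_of_real x) * Gamma (1 - complex_of_real x) = of_real pi / sin (of_real pi * of_real x)"
    by (rule Gamma_reflection_complex)
  then have "complex_of_real (Gamma x * Gamma (1 - x)) = complex_of_real (pi / sin (pi * x))"
    by (simp only: of_real_mult of_real_divide Gamma_complex_of_real [symmetric]
        sin_of_real [symmetric] of_real_diff of_real_1)
  then have "Gamma x * Gamma (1 - x) = pi / sin (pi * x)"
    by (simp only: of_real_eq_iff)
  then have "ln (Gamma x) + ln (Gamma (1 - x)) = ln (pi / sin (pi * x))"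
    using assms by (metis Gamma_real_pos diff_gt_0_iff_gt ln_mult_pos)
  with \<open>sin (pi * x) > 0\<close> assms show ?thesis
    by (simp add: ln_Gamma_real_pos ln_div)
qed

lemma DERIV_eq_on_unit_interval:
  fixes f g :: "real \<Rightarrow> real"
  assumes eq: "\<And>x. \<lbrakk>0 < x; x < 1\<rbrakk> \<Longrightarrow> f x = g x" and x: "0 < x" "x < 1"
    and "(f has_real_derivative f') (at x)" "(g has_real_derivative g') (at x)"
  shows "f' = g'"
proof -
  have "eventually (\<lambda>y. f y = g y) (nhds x)"
    using x eq by (intro eventually_mono[OF eventually_nhds_in_open[of "{0<..<1}"]]) auto
  with assms(4) have "(g has_real_derivative f') (at x)"
    by (simp add: DERIV_cong_ev)
  with assms(5) show ?thesis by (rule DERIV_unique[rotated])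
qed

lemma Digamma_reflection:
  assumes "0 < x" "x < (1::real)"
  shows "Digamma x - Digamma (1 - x) = - (pi * cos (pi * x) / sin (pi * x))"
proof -
  have "sin (pi * x) > 0"
    using assms by (intro sin_gt_zero) auto
  then show ?thesis
    using assms
    by (intro DERIV_eq_on_unit_interval[where f = "\<lambda>x. ln_Gamma x + ln_Gamma (1 - x)" and
          g = "\<lambda>x. ln pi - ln (sin (pi * x))", OF ln_Gamma_reflection assms])
       (auto intro!: derivative_eq_intros simp: field_simps)
qed

lemma Trigamma_reflection:
  assumes "0 < x" "x < (1::real)"
  shows "Polygamma 1 x + Polygamma 1 (1 - x) = pi ^ 2 / sin (pi * x) ^ 2"
proof -
  have s: "sin (pi * x) > 0"
    using assms by (intro sin_gt_zero) auto
  have "pi * (pi * (cos (pi * x) * cos (pi * x))) + pi * (pi * (sin (pi * x) * sin (pi * x))) =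
      pi * pi * (sin (pi * x) ^ 2 + cos (pi * x) ^ 2)"
    by algebra
  then have pythagoras: "- (pi * (pi * (sin (pi * x) * sin (pi * x)))) - pi * (pi * (cos (pi * x) * cos (pi * x))) = - (pi * pi)"
    by simp
  have "((\<lambda>x. - (pi * cos (pi * x) / sin (pi * x))) has_real_derivative pi ^ 2 / sin (pi * x) ^ 2) (at x)"
    using s by (auto intro!: derivative_eq_intros simp: power2_eq_square algebra_simps pythagoras)
  moreover have "((\<lambda>x. Digamma x - Digamma (1 - x)) has_real_derivative
      Polygamma 1 x + Polygamma 1 (1 - x)) (at x)"
    using assms by (auto intro!: derivative_eq_intros dest: nonpos_Ints_nonpos)
  ultimately show ?thesis
    by (intro DERIV_eq_on_unit_interval[where f = "\<lambda>x. Digamma x - Digamma (1 - x)" and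
          g = "\<lambda>x. - (pi * cos (pi * x) / sin (pi * x))", OF Digamma_reflection assms])
qed

lemma Tetragamma_reflection:
  assumes "0 < x" "x < (1::real)"
  shows "Polygamma 2 x - Polygamma 2 (1 - x) = - 2 * pi ^ 3 * cos (pi * x) / sin (pi * x) ^ 3"
proof -
  have s: "sin (pi * x) > 0"
    using assms by (intro sin_gt_zero) auto
  then show ?thesis
    using assms
    by (intro DERIV_eq_on_unit_interval[where f = "\<lambda>x. Polygamma 1 x + Polygamma 1 (1 - x)" and
          g = "\<lambda>x. pi ^ 2 / sin (pi * x) ^ 2", OF Trigamma_reflection assms])
       (auto intro!: derivative_eq_intros dest: nonpos_Ints_nonpos simp: field_simps numeral_2_eq_2 power3_eq_cube)
qed

lemma summable_dirichlet_beta: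
  assumes "s \<ge> 2"
  shows "summable (\<lambda>k. (-1) ^ k / (2 * real k + 1) ^ s)"
proof (rule summable_comparison_test')
  show "summable (\<lambda>k. inverse (real (Suc k)) ^ s)"
    using inverse_power_summable[OF assms, where 'a = real] by (subst summable_Suc_iff) (simp add: power_inverse)
  show "norm ((-1) ^ k / (2 * real k + 1) ^ s) \<le> inverse (real (Suc k)) ^ s" for k
    by (auto simp: power_inverse abs_mult intro!: le_imp_inverse_le power_mono simp flip: inverse_eq_divide)
qed

lemma dirichlet_beta_3: "dirichlet_beta 3 = pi ^ 3 / 32"
proof -
  have eq: "Polygamma 2 (1/4) - Polygamma 2 (3/4) = - 4 * pi ^ 3"
  proof -
    have "cos (pi * (1/4)) = 2 * sin (pi * (1/4)) ^ 3" "sin (pi * (1/4)) \<noteq> 0"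
      by (simp_all add: sin_45 cos_45 power3_eq_cube)
    then show ?thesis using Tetragamma_reflection[of "1/4"] by simp
  qed
  have P: "(\<lambda>k. 1 / (z + real k) ^ 3) sums (- Polygamma 2 z / 2)" if "z > 0" for z :: real
    using Polygamma_LIMSEQ[of z 2] that by (simp add: numeral_3_eq_3 numeral_2_eq_2 field_simps)
  have "(\<lambda>k. (1 / (1/4 + real k) ^ 3 - 1 / (3/4 + real k) ^ 3) / 64) sums
          ((- Polygamma 2 (1/4) / 2 - (- Polygamma 2 (3/4) / 2)) / 64)"
    by (intro sums_divide sums_diff P) auto
  also have "(- Polygamma 2 (1/4) / 2 - (- Polygamma 2 (3/4) / 2)) / 64 = pi ^ 3 / 32"
    using eq by (simp add: field_simps)
  also have "(\<lambda>k. (1 / (1/4 + real k) ^ 3 - 1 / (3/4 + real k) ^ 3) / 64) =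
             (\<lambda>k. \<Sum>i\<in>{k * 2..<k * 2 + 2}. (-1) ^ i / (2 * real i + 1) ^ 3)"
  proof
    fix k
    have "{k * 2..<k * 2 + 2} = {2 * k, Suc (2 * k)}" by auto
    moreover have "1 / (1/4 + real k) ^ 3 / 64 = 1 / (4 * real k + 1) ^ 3"
      "1 / (3/4 + real k) ^ 3 / 64 = 1 / (4 * real k + 3) ^ 3"
    proof -
      have "1/4 + real k = (4 * real k + 1) / 4" "3/4 + real k = (4 * real k + 3) / 4" by simp_all
      then show "1 / (1/4 + real k) ^ 3 / 64 = 1 / (4 * real k + 1) ^ 3"
        "1 / (3/4 + real k) ^ 3 / 64 = 1 / (4 * real k + 3) ^ 3"
        by (simp_all only: power_divide) simp_all
    qed
    ultimately show "(1 / (1/4 + real k) ^ 3 - 1 / (3/4 + real k) ^ 3) / 64 =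
          (\<Sum>i\<in>{k * 2..<k * 2 + 2}. (-1) ^ i / (2 * real i + 1) ^ 3)"
      by (simp add: diff_divide_distrib add.commute)
  qed
  finally have grouped: "(\<lambda>k. \<Sum>i\<in>{k * 2..<k * 2 + 2}. (-1) ^ i / (2 * real i + 1) ^ 3) sums (pi ^ 3 / 32)" .
  have "(\<lambda>k. \<Sum>i\<in>{k * 2..<k * 2 + 2}. (-1) ^ i / (2 * real i + 1) ^ 3) sums dirichlet_beta 3"
    unfolding dirichlet_beta_def
    by (rule sums_group[OF summable_sums[OF summable_dirichlet_beta]]) simp_all
  then show ?thesis using grouped by (rule sums_unique2)
qed

section \<open>Telescoping along a diagonal\<close>

text \<open>
  Let \<open>R n\<close> be the tail of the row \<open>f (2 * n)\<close> that starts at the diagonal entry \<open>m = n\<close>. Passing from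
  \<open>R n\<close> to \<open>R (Suc n)\<close> drops that diagonal entry and then moves the tail two rows down; the
  difference of neighbouring rows telescopes, so that each of the two moves costs one boundary value
  of \<open>h\<close>. Hence the stated terms are \<open>R n - R (Suc n)\<close>, and they add up to \<open>R 0\<close> because \<open>R\<close> tends to 0.
\<close>

lemma sums_diagonal_tails:
  fixes f h :: "nat \<Rightarrow> nat \<Rightarrow> real"
  assumes step: "\<And>N m. f N m - f (Suc N) m = h (Suc N) m - h (Suc N) (Suc m)"
    and h_null: "\<And>N. (h (Suc N)) \<longlonglongrightarrow> 0"
    and bound: "\<And>n m. n \<le> m \<Longrightarrow> \<bar>f (2 * n) m\<bar> \<le> b n * g m"
    and g: "summable g" and b: "b \<longlonglongrightarrow> 0"
  shows "(\<lambda>n. f (2 * n) n + h (2 * n + 1) (Suc n) + h (2 * n + 2) (Suc n)) sums (\<Sum>m. f 0 m)"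
proof -
  define R where "R n = (\<Sum>m. f (2 * n) (m + n))" for n
  have summ: "summable (f (2 * n))" for n
    by (rule summable_comparison_test'[OF summable_mult[OF g, of "b n"], of n]) (use bound in simp)
  have summ': "summable (\<lambda>m. f (2 * n) (m + k))" for n k
    using summ by (subst summable_iff_shift)
  have tel: "(\<lambda>m. f N (m + n) - f (Suc N) (m + n)) sums h (Suc N) n" for N n
    using telescope_sums'[OF LIMSEQ_ignore_initial_segment[OF h_null[of N], of n]]
    by (simp add: step)
  have diff: "R n - R (Suc n) = f (2 * n) n + h (2 * n + 1) (Suc n) + h (2 * n + 2) (Suc n)" for n
  proof -
    have "(\<lambda>m. f (2 * n) (m + Suc n) - f (2 * Suc n) (m + Suc n)) sums
            (h (2 * n + 1) (Suc n) + h (2 * n + 2) (Suc n))"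
      using sums_add[OF tel[of "2 * n" "Suc n"] tel[of "Suc (2 * n)" "Suc n"]] by simp
    from sums_unique[OF this] suminf_diff[OF summ' summ', of n "Suc n" "Suc n" "Suc n"]
    have "(\<Sum>m. f (2 * n) (m + Suc n)) - R (Suc n) = h (2 * n + 1) (Suc n) + h (2 * n + 2) (Suc n)"
      by (simp add: R_def)
    moreover have "R n = f (2 * n) n + (\<Sum>m. f (2 * n) (m + Suc n))"
      unfolding R_def using suminf_split_head[OF summ'[of n n]] by simp
    ultimately show ?thesis by simp
  qed
  have bnd: "norm (R n) \<le> b n * (\<Sum>m. g (m + n))" for n
  proof -
    have sg: "summable (\<lambda>m. g (m + n))"
      using g by (subst summable_iff_shift)
    have "norm (R n) \<le> (\<Sum>m. b n * g (m + n))"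
      unfolding R_def by (rule norm_suminf_le[OF _ summable_mult[OF sg]]) (use bound in simp)
    then show ?thesis using suminf_mult[OF sg] by simp
  qed
  have "(\<lambda>n. b n * (\<Sum>m. g (m + n))) \<longlonglongrightarrow> 0 * 0"
    by (intro tendsto_mult b suminf_exist_split2 g)
  then have "R \<longlonglongrightarrow> 0"
    by (intro Lim_null_comparison[OF always_eventually[OF allI[OF bnd]]]) simp
  from telescope_sums'[OF this]
  have "(\<lambda>n. f (2 * n) n + h (2 * n + 1) (Suc n) + h (2 * n + 2) (Suc n)) sums R 0"
    by (simp only: diff diff_zero)
  then show ?thesis by (simp add: R_def)
qed

section \<open>The kernel\<close>

abbreviation half :: "nat \<Rightarrow> real" where
  "half m \<equiv> real m + 1 / 2"

lemma half_non_Int: "real m + 1 / 2 \<notin> \<int>"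
proof
  assume "real m + 1 / 2 \<in> \<int>"
  then obtain z where "real m + 1 / 2 = of_int z" by (auto elim: Ints_cases)
  then have "of_int (2 * int m + 1) = (of_int (2 * z) :: real)" by simp
  then have "2 * int m + 1 = 2 * z" by (simp only: of_int_eq_iff)
  then show False by presburger
qed

definition kernel :: "nat \<Rightarrow> real \<Rightarrow> real" where
  "kernel N s = (\<Prod>i=1..N. real i ^ 2 / (real i ^ 2 - s ^ 2))"

lemma kernel_0 [simp]: "kernel 0 s = 1"
  by (simp add: kernel_def)

lemma kernel_Suc: "kernel (Suc N) s = kernel N s * (real (Suc N) ^ 2 / (real (Suc N) ^ 2 - s ^ 2))"
  by (simp add: kernel_def)

lemma non_Int_cases:
  assumes "s \<notin> \<int>"
  shows "s - real i \<noteq> 0" "s + real i \<noteq> 0" "real i ^ 2 - s ^ 2 \<noteq> 0"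
proof -
  have "s \<noteq> of_int (int i)" "s \<noteq> of_int (- int i)"
    using assms by (metis Ints_of_int)+
  then show "s - real i \<noteq> 0" "s + real i \<noteq> 0" by auto
  then show "real i ^ 2 - s ^ 2 \<noteq> 0"
    by (simp add: power2_eq_iff add_eq_0_iff2)
qed

text \<open>
  Up to the factor \<open>s\<close> and a constant, the kernel is \<open>1 / ((s - N) \<dots> (s + N))\<close>, and the shift replaces
  the linear factor \<open>s - N\<close> by \<open>s + N + 1\<close>.
\<close>

lemma kernel_shift:
  assumes "s \<notin> \<int>"
  shows "kernel N (s + 1) * (s * (s + real N + 1)) = kernel N s * ((s + 1) * (s - real N))"
proof (induction N)
  case (Suc N)
  have nz: "s - real N \<noteq> 0" "s + real (Suc N) \<noteq> 0" "s + real (Suc (Suc N)) \<noteq> 0" "s - real (Suc N) \<noteq> 0"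
    using non_Int_cases[OF assms] by blast+
  have fac: "real (Suc N) ^ 2 - (s + 1) ^ 2 = - ((s - real N) * (s + real (Suc (Suc N))))"
    "real (Suc N) ^ 2 - s ^ 2 = - ((s - real (Suc N)) * (s + real (Suc N)))"
    by (simp_all add: power2_eq_square algebra_simps)
  define Q where "Q = real (Suc N) ^ 2"
  have cancel1: "K * (Q / - (a * b)) * (s * b) = K * (s * d) * (- Q / (a * d))"
    if "a \<noteq> 0" "b \<noteq> 0" "d \<noteq> 0" for K a b d :: real
    using that by (simp add: field_simps)
  have cancel2: "K * ((s + 1) * a) * (- Q / (a * d)) = K * (Q / - (c * d)) * ((s + 1) * c)"
    if "a \<noteq> 0" "c \<noteq> 0" "d \<noteq> 0" for K a c d :: real
    using that by (simp add: field_simps)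
  have "kernel (Suc N) (s + 1) * (s * (s + real (Suc N) + 1)) =
        kernel N (s + 1) * (s * (s + real N + 1)) * (- Q / ((s - real N) * (s + real (Suc N))))"
    unfolding kernel_Suc fac using cancel1[OF nz(1,3,2)] by (simp add: Q_def add_ac)
  also have "\<dots> = kernel (Suc N) s * ((s + 1) * (s - real (Suc N)))"
    unfolding Suc kernel_Suc fac Q_def by (rule cancel2[OF nz(1,4,2), unfolded Q_def])
  finally show ?case .
qed simp

lemma kernel_null: "(\<lambda>m. kernel (Suc N) (real m + 1 / 2)) \<longlonglongrightarrow> 0"
proof -
  have fac: "(\<lambda>m. real (Suc N) ^ 2 / (real (Suc N) ^ 2 - (real m + 1 / 2) ^ 2)) \<longlonglongrightarrow> 0" for N
    by real_asymp
  have "\<exists>L. (\<lambda>m. kernel N (real m + 1 / 2)) \<longlonglongrightarrow> L"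
  proof (induction N)
    case 0
    then show ?case by (auto intro: tendsto_const)
  next
    case (Suc N)
    then show ?case unfolding kernel_Suc using tendsto_mult fac by blast
  qed
  then obtain L where "(\<lambda>m. kernel N (real m + 1 / 2)) \<longlonglongrightarrow> L" by blast
  from tendsto_mult[OF this fac[of N]] show ?thesis
    unfolding kernel_Suc by simp
qed

text \<open>
  Each step to the right multiplies the kernel by \<open>(s + 1) (s - N) / (s (s + N + 1))\<close>, which has
  absolute value at most 1 as long as \<open>N \<le> 2 s\<close>. From the diagonal onwards this holds for \<open>N = 2 n\<close>, so
  one estimate on the diagonal controls a whole tail.
\<close>

lemma abs_kernel_antimono:
  assumes "n \<le> m"
  shows "\<bar>kernel (2 * n) (real m + 1 / 2)\<bar> \<le> \<bar>kernel (2 * n) (real n + 1 / 2)\<bar>"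
  using assms
proof (induction m rule: dec_induct)
  case (step m)
  define s where "s = real m + 1 / 2"
  define N where "N = 2 * n"
  have s: "s > 0" "real N \<le> 2 * s" and eq: "real (Suc m) + 1 / 2 = s + 1"
    using step(1) by (auto simp: s_def N_def)
  have "\<bar>kernel N (s + 1)\<bar> * (s * (s + real N + 1)) = \<bar>kernel N (s + 1) * (s * (s + real N + 1))\<bar>"
    using s by (simp add: abs_mult)
  also have "\<dots> = \<bar>kernel N s\<bar> * ((s + 1) * \<bar>s - real N\<bar>)"
    unfolding s_def kernel_shift[OF half_non_Int] by (simp add: abs_mult)
  also have "(s + 1) * \<bar>s - real N\<bar> \<le> s * (s + real N + 1)"
  proof (cases "s \<ge> real N")
    case False
    then have abs: "\<bar>s - real N\<bar> = real N - s" by simp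
    have "s * (s + real N + 1) - (s + 1) * (real N - s) = (2 * s - real N) + 2 * s * s"
      by (simp add: algebra_simps)
    moreover have "2 * s * s \<ge> 0" using s by simp
    ultimately show ?thesis unfolding abs using False s by linarith
  next
    case True
    then have abs: "\<bar>s - real N\<bar> = s - real N" by simp
    have "s * (s + real N + 1) - (s + 1) * (s - real N) = 2 * s * real N + real N"
      by (simp add: algebra_simps)
    moreover have "2 * s * real N \<ge> 0" using s by simp
    ultimately show ?thesis unfolding abs using of_nat_0_le_iff[of N, where 'a = real] by linarith
  qed
  finally have "\<bar>kernel N (s + 1)\<bar> * (s * (s + real N + 1)) \<le> \<bar>kernel N s\<bar> * (s * (s + real N + 1))"
    by (simp add: mult_left_mono)
  then have "\<bar>kernel N (s + 1)\<bar> \<le> \<bar>kernel N s\<bar>"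
    using s by (simp add: mult_le_cancel_right)
  with step.IH show ?case unfolding eq N_def[symmetric] by (simp add: s_def)
qed simp

section \<open>Binomial form of the kernel on the diagonal\<close>

text \<open>
  This is the hypergeometric term \<open>(16/27)\<^sup>k (1)\<^sub>k\<^sup>2 / ((1/6)\<^sub>k (5/6)\<^sub>k)\<close> in terms of rising factorials.
\<close>

definition inv_binom :: "nat \<Rightarrow> real" where
  "inv_binom k = 256 ^ k / (real ((3*k) choose k) * real ((6*k) choose (3*k)))"

lemma inv_binom_pos: "inv_binom k > 0"
  by (simp add: inv_binom_def)

lemma inv_binom_fact: "inv_binom k = 256 ^ k * fact k * fact (2 * k) * fact (3 * k) / fact (6 * k)"
proof -
  have "real ((3*k) choose k) = fact (3 * k) / (fact k * fact (2 * k))"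
    "real ((6*k) choose (3*k)) = fact (6 * k) / (fact (3 * k) * fact (3 * k))"
    by (simp_all add: binomial_fact)
  then show ?thesis by (simp add: inv_binom_def)
qed

lemma inv_binom_Suc:
  "inv_binom (Suc k) = inv_binom k * (64 * (real k + 1) ^ 2 / (3 * (6 * real k + 1) * (6 * real k + 5)))"
proof -
  have f: "fact (2 * Suc k) = (2 * real k + 2) * (2 * real k + 1) * fact (2 * k)"
    "fact (3 * Suc k) = (3 * real k + 3) * (3 * real k + 2) * (3 * real k + 1) * fact (3 * k)"
    "fact (6 * Suc k) = (6 * real k + 6) * (6 * real k + 5) * (6 * real k + 4) * (6 * real k + 3)
       * (6 * real k + 2) * (6 * real k + 1) * fact (6 * k)"
    by (simp_all add: eval_nat_numeral fact_reduce algebra_simps)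
  define x where "x = real k"
  have x: "x \<ge> 0" by (simp add: x_def)
  have nz: "x + 1 \<noteq> 0" "3 * x + 2 \<noteq> 0" "2 * x + 1 \<noteq> 0" "3 * x + 1 \<noteq> 0" "6 * x + 1 \<noteq> 0" "6 * x + 5 \<noteq> 0"
    using x by auto
  have fk: "fact (Suc k) = (x + 1) * (fact k :: real)" by (simp add: x_def)
  show ?thesis
    unfolding inv_binom_fact f fk x_def[symmetric]
    using nz by (simp add: divide_simps) (simp add: power2_eq_square algebra_simps)
qed

text \<open>
  On the diagonal \<open>N = 2 n\<close>, \<open>s = n + 1/2\<close> the denominator of the kernel consists of all half-integers from
  \<open>1/2 - n\<close> to \<open>3 n + 1/2\<close>. The half-integers below \<open>n\<close> occur with both signs, and what remains is a
  quotient of factorials: this is where the binomial coefficients of the series come from.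
\<close>

lemma kernel_diagonal:
  "kernel (2 * n) (real n + 1 / 2) = (-1) ^ n * inv_binom n * ((2 * real n + 1) / (6 * real n + 1))"
proof (induction n)
  case (Suc n)
  define x where "x = real n"
  have x: "x \<ge> 0" and xh: "2 * x \<noteq> 1"
    using non_Int_cases(1)[OF half_non_Int[of 0], of n] by (auto simp: x_def)
  have nz: "2 * x + 1 \<noteq> 0" "6 * x + 1 \<noteq> 0" "6 * x + 3 \<noteq> 0" "6 * x + 5 \<noteq> 0" "6 * x + 7 \<noteq> 0" "2 * x - 1 \<noteq> 0"
    using x xh by auto
  have "kernel (2 * n) (x + 3 / 2) * ((x + 1 / 2) * (3 * x + 3 / 2)) =
        kernel (2 * n) (x + 1 / 2) * ((x + 3 / 2) * (1 / 2 - x))"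
    using kernel_shift[OF half_non_Int, of "2 * n" n] by (simp add: x_def add_ac)
  moreover have "(x + 1 / 2) * (3 * x + 3 / 2) = (2 * x + 1) * (6 * x + 3) / 4"
    "(x + 3 / 2) * (1 / 2 - x) = - ((2 * x + 3) * (2 * x - 1)) / 4"
    by (simp_all add: field_simps)
  ultimately have "kernel (2 * n) (x + 3 / 2) * ((2 * x + 1) * (6 * x + 3)) =
      kernel (2 * n) (x + 1 / 2) * (- ((2 * x + 3) * (2 * x - 1)))"
    by simp
  moreover have "(2 * x + 1) * (6 * x + 3) \<noteq> 0"
    using nz(1,3) by simp
  ultimately have shift: "kernel (2 * n) (x + 3 / 2) =
      kernel (2 * n) (x + 1 / 2) * (- ((2 * x + 3) * (2 * x - 1)) / ((2 * x + 1) * (6 * x + 3)))"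
    by (subst times_divide_eq_right) (rule eq_divide_imp)
  have "kernel (2 * Suc n) (real (Suc n) + 1 / 2) = kernel (2 * n) (x + 3 / 2)
          * ((2 * x + 1) ^ 2 / ((2 * x + 1) ^ 2 - (x + 3 / 2) ^ 2))
          * ((2 * x + 2) ^ 2 / ((2 * x + 2) ^ 2 - (x + 3 / 2) ^ 2))"
    by (simp add: kernel_Suc x_def add_ac)
  also have "(2 * x + 1) ^ 2 - (x + 3 / 2) ^ 2 = (2 * x - 1) * (6 * x + 5) / 4"
    by (simp add: power2_eq_square algebra_simps)
  also have "(2 * x + 2) ^ 2 - (x + 3 / 2) ^ 2 = (2 * x + 1) * (6 * x + 7) / 4"
    by (simp add: power2_eq_square algebra_simps)
  also have "kernel (2 * n) (x + 3 / 2) * ((2 * x + 1) ^ 2 / ((2 * x - 1) * (6 * x + 5) / 4))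
          * ((2 * x + 2) ^ 2 / ((2 * x + 1) * (6 * x + 7) / 4)) =
        (-1) ^ Suc n * (inv_binom n * (64 * (x + 1) ^ 2 / (3 * (6 * x + 1) * (6 * x + 5)))) *
          ((2 * x + 3) / (6 * x + 7))"
    unfolding shift Suc[folded x_def] using nz
    by (simp add: divide_simps) (simp add: power2_eq_square algebra_simps)
  finally show ?case
    by (simp add: inv_binom_Suc x_def add_ac)
qed (simp add: inv_binom_def)

lemma inv_binom_null: "(\<lambda>n. (real n + 1) * inv_binom n) \<longlonglongrightarrow> 0"
proof (rule summable_LIMSEQ_zero, rule summable_ratio_test)
  \<comment> \<open>The ratio of consecutive terms tends to 16/27; it is at most 9/10 from index 4 on.\<close>
  fix n :: nat assume n: "n \<ge> 4"
  define x where "x = real n"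
  have x: "x \<ge> 4" using n by (simp add: x_def)
  have "(x + 2) * (64 * (x + 1) ^ 2) \<le> 9 / 10 * (x + 1) * (3 * (6 * x + 1) * (6 * x + 5))"
  proof -
    \<comment> \<open>Ten times the right-hand side minus ten times the left-hand side, written so that the sign is visible for \<open>x \<ge> 4\<close>.\<close>
    have "0 \<le> (x + 1) * ((x - 4) * (332 * x + 380) + 375)" using x by simp
    then have "10 * ((x + 2) * (64 * (x + 1) ^ 2)) \<le> 9 * ((x + 1) * (3 * (6 * x + 1) * (6 * x + 5)))"
      by (simp add: power2_eq_square algebra_simps)
    then show ?thesis by linarith
  qed
  then have "(x + 2) * (64 * (x + 1) ^ 2 / (3 * (6 * x + 1) * (6 * x + 5))) \<le> 9 / 10 * (x + 1)"
    using x by (simp add: divide_le_eq)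
  from mult_left_mono[OF this less_imp_le[OF inv_binom_pos[of n]]]
  show "norm ((real (Suc n) + 1) * inv_binom (Suc n)) \<le> 9 / 10 * norm ((real n + 1) * inv_binom n)"
    using inv_binom_pos[of n] inv_binom_pos[of "Suc n"] by (simp add: inv_binom_Suc x_def mult_ac add_ac)
qed simp

section \<open>Acceleration of weighted alternating sums\<close>

lemma alternating_half_eq: "(-1) ^ m / half m ^ s = 2 ^ s * ((-1) ^ m / (2 * real m + 1) ^ s)"
proof -
  have "half m = (2 * real m + 1) / 2" by simp
  then show ?thesis by (simp only: power_divide) simp
qed

lemma summable_alternating_half:
  assumes "s \<ge> 2"
  shows "summable (\<lambda>m. (-1) ^ m / half m ^ s)"
  unfolding alternating_half_eq by (rule summable_mult[OF summable_dirichlet_beta[OF assms]])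

lemma suminf_alternating_half:
  assumes "s \<ge> 2"
  shows "(\<Sum>m. (-1) ^ m / half m ^ s) = 2 ^ s * dirichlet_beta s"
  unfolding alternating_half_eq dirichlet_beta_def
  by (rule suminf_mult[OF summable_dirichlet_beta[OF assms]])

abbreviation prefactor :: "nat \<Rightarrow> real" where
  "prefactor k \<equiv> inv_binom k / ((2 * real k - 1) * real k ^ 2)"

text \<open>
  The two-row relation of \<open>sums_diagonal_tails\<close> is satisfied by
  \<open>f N m = (-1)^m * kernel N s / s\<^sup>2 * W N s\<close> and
  \<open>h N m = - (-1)^m * (s + N) / (2 * N\<^sup>2 * s) * kernel N s * V N s\<close> with \<open>s = m + 1/2\<close>. For \<open>W = V = 1\<close> this
  is the telescoping of \<open>(-1)^m * s / ((s - N) \<dots> (s + N))\<close>; in general it reduces, after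
  division by the kernel, to the first hypothesis, a linear relation between the two weights. The
  diagonal closed form of the kernel then turns the diagonal entry and the two boundary values into
  rational multiples of the same binomial term, with coefficients \<open>6 (6 k - 1)\<close>, \<open>- (6 k - 1)\<close> and
  \<open>- 4 (2 k - 1)\<close>; for constant weights they add up to \<open>22 k - 1\<close>. The index is \<open>k = Suc n\<close>.
\<close>

theorem weighted_acceleration:
  fixes W V :: "nat \<Rightarrow> real \<Rightarrow> real"
  assumes eq: "\<And>N s. s \<notin> \<int> \<Longrightarrow>
      (real (Suc N) ^ 2 - s ^ 2) * W N s - real (Suc N) ^ 2 * W (Suc N) s =
      - s / 2 * ((s + real (Suc N)) * V (Suc N) s + (s - real (Suc N)) * V (Suc N) (s + 1))"
    and W: "\<And>N m. \<bar>W N (half m)\<bar> \<le> C * (real N + 1)"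
    and V: "\<And>N m. \<bar>V (Suc N) (half m)\<bar> \<le> C * (real N + 1)"
  shows "(\<lambda>k. inv_binom k / ((2 * real k - 1) * real k ^ 2) *
            (6 * (6 * real k - 1) * W (2 * k - 2) (real k - 1 / 2)
             - (6 * real k - 1) * V (2 * k - 1) (real k + 1 / 2)
             - 4 * (2 * real k - 1) * V (2 * k) (real k + 1 / 2)))
         sums_from_1 (32 * (\<Sum>m. (-1) ^ m * W 0 (half m) / half m ^ 2))"
proof -
  define f where "f N m = (-1) ^ m * kernel N (half m) / half m ^ 2 * W N (half m)" for N m
  define h where "h N m = - ((-1) ^ m * ((half m + real N) / (2 * real N ^ 2 * half m)) *
      kernel N (half m) * V N (half m))" for N m
  define g where "g m = 1 / half m ^ 2" for m
  have step: "f N m - f (Suc N) m = h (Suc N) m - h (Suc N) (Suc m)" for N m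
  proof -
    define s where "s = half m"
    define q where "q = real (Suc N)"
    define K where "K = kernel (Suc N) s"
    have s: "s > 0" "q > 0" "s + 1 = half (Suc m)" by (auto simp: s_def q_def)
    have nz: "q ^ 2 - s ^ 2 \<noteq> 0"
      unfolding q_def s_def by (rule non_Int_cases[OF half_non_Int])
    have K0: "kernel N s = K * ((q ^ 2 - s ^ 2) / q ^ 2)"
      unfolding K_def kernel_Suc q_def[symmetric] using nz s by simp
    have "kernel (Suc N) (s + 1) * (s * (s + q + 1)) = K * ((s + 1) * (s - q))"
      unfolding K_def q_def s_def by (rule kernel_shift[OF half_non_Int])
    then have K1: "kernel (Suc N) (s + 1) = K * ((s + 1) * (s - q)) / (s * (s + q + 1))"
      using s by (simp add: nonzero_eq_divide_eq)
    have W': "W (Suc N) s = ((q ^ 2 - s ^ 2) * W N s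
        + s / 2 * ((s + q) * V (Suc N) s + (s - q) * V (Suc N) (s + 1))) / q ^ 2"
      using eq[OF half_non_Int, of N m, folded s_def q_def] s
      by (simp add: nonzero_eq_divide_eq) (simp add: algebra_simps)
    have signs: "e * (- (a * K * v) - b * K' * v') = - (e * a * K * v) - - (- 1 * e * b * K' * v')"
      for e a K v b K' v' :: real
      by (simp add: algebra_simps)
    have "f N m - f (Suc N) m = (-1) ^ m * (K * ((q ^ 2 - s ^ 2) / q ^ 2) / s ^ 2 * W N s - K / s ^ 2 * W (Suc N) s)"
      unfolding f_def s_def[symmetric] K0 by (simp add: K_def algebra_simps)
    also have "\<dots> = (-1) ^ m * (- ((s + q) / (2 * q ^ 2 * s) * K * V (Suc N) s)
        - ((s + 1 + q) / (2 * q ^ 2 * (s + 1)) * (K * ((s + 1) * (s - q)) / (s * (s + q + 1))) * V (Suc N) (s + 1)))"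
      unfolding W' using s
      by (simp add: divide_simps add_pos_pos) (simp add: algebra_simps power2_eq_square)
    also have "\<dots> = h (Suc N) m - h (Suc N) (Suc m)"
      unfolding h_def s(3)[symmetric] s_def[symmetric] q_def[symmetric] K1 K_def[symmetric] power_Suc
      by (rule signs)
    finally show ?thesis .
  qed
  have h_null: "(h (Suc N)) \<longlonglongrightarrow> 0" for N
  proof (rule Lim_null_comparison)
    define F where "F m = (half m + real (Suc N)) / (2 * real (Suc N) ^ 2 * half m)" for m
    have "F \<longlonglongrightarrow> 1 / (2 * real (Suc N) ^ 2)"
      unfolding F_def by (real_asymp simp: inverse_eq_divide)
    from tendsto_mult[OF tendsto_mult[OF this tendsto_rabs[OF kernel_null[of N]]] tendsto_const]
    show "(\<lambda>m. F m * \<bar>kernel (Suc N) (half m)\<bar> * (C * (real N + 1))) \<longlonglongrightarrow> 0" by simp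
    have "norm (h (Suc N) m) = F m * \<bar>kernel (Suc N) (half m)\<bar> * \<bar>V (Suc N) (half m)\<bar>" for m
      by (simp add: h_def F_def abs_mult)
    moreover have "F m \<ge> 0" for m by (simp add: F_def)
    ultimately show "eventually (\<lambda>m. norm (h (Suc N) m) \<le> F m * \<bar>kernel (Suc N) (half m)\<bar> * (C * (real N + 1))) sequentially"
      using V[of N] by (auto intro!: always_eventually mult_left_mono)
  qed
  have C: "C \<ge> 0" using W[of 0 0] by simp
  define b where "b n = \<bar>kernel (2 * n) (half n)\<bar> * (C * (real (2 * n) + 1))" for n
  have bound: "\<bar>f (2 * n) m\<bar> \<le> b n * g m" if "n \<le> m" for n m
  proof -
    have "\<bar>f (2 * n) m\<bar> = \<bar>kernel (2 * n) (half m)\<bar> * \<bar>W (2 * n) (half m)\<bar> * g m"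
      by (simp add: f_def g_def abs_mult)
    also have "\<dots> \<le> b n * g m"
      unfolding b_def using abs_kernel_antimono[OF that] W[of "2 * n" m] C
      by (intro mult_right_mono mult_mono) (auto simp: g_def)
    finally show ?thesis .
  qed
  have g: "summable g"
  proof (rule summable_comparison_test')
    show "summable (\<lambda>m. 4 * inverse (real (Suc m) ^ 2))"
      using inverse_power_summable[of 2, where 'a = real]
      by (intro summable_mult) (subst summable_Suc_iff, simp)
    fix m
    have "(real (Suc m)) ^ 2 \<le> (2 * half m) ^ 2" by (intro power_mono) auto
    then have "real (Suc m) ^ 2 \<le> 4 * half m ^ 2" by (simp only: power_mult_distrib) simp
    then show "norm (g m) \<le> 4 * inverse (real (Suc m) ^ 2)"
      by (simp add: g_def divide_simps)
  qed
  have b: "b \<longlonglongrightarrow> 0"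
  proof (rule Lim_null_comparison)
    show "(\<lambda>n. 2 * C * ((real n + 1) * inv_binom n)) \<longlonglongrightarrow> 0"
      using tendsto_mult[OF tendsto_const inv_binom_null, of "2 * C"] by simp
    have "norm (b n) \<le> 2 * C * ((real n + 1) * inv_binom n)" for n
    proof -
      have "(2 * real n + 1) / (6 * real n + 1) \<le> 1" by simp
      then have "inv_binom n * ((2 * real n + 1) / (6 * real n + 1)) \<le> inv_binom n * 1"
        using inv_binom_pos[of n] by (intro mult_left_mono) auto
      then have "\<bar>kernel (2 * n) (half n)\<bar> \<le> inv_binom n"
        using inv_binom_pos[of n] by (simp add: kernel_diagonal abs_mult)
      then have "b n \<le> inv_binom n * (C * (2 * (real n + 1)))"
        unfolding b_def using C inv_binom_pos[of n] by (intro mult_mono) auto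
      moreover have "b n \<ge> 0" using C by (simp add: b_def)
      ultimately show ?thesis by (simp add: mult_ac)
    qed
    then show "eventually (\<lambda>n. norm (b n) \<le> 2 * C * ((real n + 1) * inv_binom n)) sequentially"
      by (rule always_eventually[OF allI])
  qed
  have "(\<lambda>n. 32 * (f (2 * n) n + h (2 * n + 1) (Suc n) + h (2 * n + 2) (Suc n))) sums (32 * (\<Sum>m. f 0 m))"
    by (intro sums_mult sums_diagonal_tails[OF step h_null bound g b])
  also have "(\<lambda>n. 32 * (f (2 * n) n + h (2 * n + 1) (Suc n) + h (2 * n + 2) (Suc n))) =
    (\<lambda>n. (\<lambda>k. inv_binom k / ((2 * real k - 1) * real k ^ 2) *
            (6 * (6 * real k - 1) * W (2 * k - 2) (real k - 1 / 2)
             - (6 * real k - 1) * V (2 * k - 1) (real k + 1 / 2)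
             - 4 * (2 * real k - 1) * V (2 * k) (real k + 1 / 2))) (Suc n))"
  proof
    fix n
    define x where "x = real n"
    define t where "t = inv_binom (Suc n)"
    have x: "x \<ge> 0" by (simp add: x_def)
    have nz: "x + 1 \<noteq> 0" "2 * x + 1 \<noteq> 0" "2 * x + 3 \<noteq> 0" "6 * x + 1 \<noteq> 0" "6 * x + 5 \<noteq> 0" "6 * x + 7 \<noteq> 0"
      using x by auto
    \<comment> \<open>The diagonal entry comes from \<open>n\<close>, the boundary values from \<open>Suc n\<close>; all are written in terms of \<open>t\<close>.\<close>
    have t0: "inv_binom n = t * (3 * (6 * x + 1) * (6 * x + 5)) / (64 * (x + 1) ^ 2)"
      unfolding t_def inv_binom_Suc x_def[symmetric] using nz by (simp add: divide_simps)
    have "kernel (2 * n) (half n) = (-1) ^ n * inv_binom n * ((2 * x + 1) / (6 * x + 1))"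
      unfolding x_def by (rule kernel_diagonal)
    also have "\<dots> = (-1) ^ n * (t * (3 * (2 * x + 1) * (6 * x + 5)) / (64 * (x + 1) ^ 2))"
      unfolding t0 using nz by (simp add: divide_simps) (simp add: algebra_simps)
    finally have k0: "kernel (2 * n) (half n) = (-1) ^ n * (t * (3 * (2 * x + 1) * (6 * x + 5)) / (64 * (x + 1) ^ 2))" .
    have k2: "kernel (2 * n + 2) (half (Suc n)) = (-1) ^ Suc n * (t * ((2 * x + 3) / (6 * x + 7)))"
      using kernel_diagonal[of "Suc n"] by (simp add: t_def x_def add_ac)
    have two: "real (2 * n + 2) = 2 * (x + 1)" by (simp add: x_def)
    have Suc_2n1: "Suc (2 * n + 1) = 2 * n + 2" by simp
    have "real (2 * n + 2) ^ 2 - half (Suc n) ^ 2 = (2 * x + 1) * (6 * x + 7) / 4"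
      by (simp add: power2_eq_square algebra_simps x_def)
    then have "kernel (2 * n + 2) (half (Suc n)) =
        kernel (2 * n + 1) (half (Suc n)) * (real (2 * n + 2) ^ 2 / ((2 * x + 1) * (6 * x + 7) / 4))"
      using kernel_Suc[of "2 * n + 1" "half (Suc n)"] unfolding Suc_2n1 by (simp only:)
    then have "kernel (2 * n + 1) (half (Suc n)) =
        kernel (2 * n + 2) (half (Suc n)) * ((2 * x + 1) * (6 * x + 7)) / (16 * (x + 1) ^ 2)"
      unfolding two using nz by (simp add: divide_simps) (simp add: power2_eq_square algebra_simps)
    also have "\<dots> = (-1) ^ Suc n * (t * ((2 * x + 3) * (2 * x + 1)) / (16 * (x + 1) ^ 2))"
      unfolding k2 using nz by (simp add: divide_simps)
    finally have k1: "kernel (2 * n + 1) (half (Suc n)) =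
      (-1) ^ Suc n * (t * ((2 * x + 3) * (2 * x + 1)) / (16 * (x + 1) ^ 2))" .
    have sq: "(-1) ^ n * ((-1) ^ n * c) = (c :: real)" for c
      by (simp flip: mult.assoc power_mult_distrib)
    define A where "A = W (2 * n) (half n)"
    define B where "B = V (2 * n + 1) (half (Suc n))"
    define D where "D = V (2 * n + 2) (half (Suc n))"
    have args: "half n = (2 * x + 1) / 2" "half (Suc n) = (2 * x + 3) / 2" "real (2 * n + 1) = 2 * x + 1"
      by (simp_all add: x_def)
    have fA: "f (2 * n) n = 3 * (6 * x + 5) * t / (16 * (2 * x + 1) * (x + 1) ^ 2) * A"
    proof -
      have "f (2 * n) n = (-1) ^ n * ((-1) ^ n * (t * (3 * (2 * x + 1) * (6 * x + 5)) / (64 * (x + 1) ^ 2) / half n ^ 2 * A))"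
        unfolding f_def k0 A_def by simp
      also have "\<dots> = 3 * (6 * x + 5) * t / (16 * (2 * x + 1) * (x + 1) ^ 2) * A"
        unfolding sq args using nz by (simp add: divide_simps) (simp add: power2_eq_square algebra_simps)
      finally show ?thesis .
    qed
    have hB: "h (2 * n + 1) (Suc n) = - (6 * x + 5) * t / (32 * (2 * x + 1) * (x + 1) ^ 2) * B"
    proof -
      have "h (2 * n + 1) (Suc n) = (-1) ^ n * ((-1) ^ n * (- ((half (Suc n) + real (2 * n + 1)) / (2 * real (2 * n + 1) ^ 2 * half (Suc n)))
          * (t * ((2 * x + 3) * (2 * x + 1)) / (16 * (x + 1) ^ 2)) * B))"
        unfolding h_def k1 B_def by simp
      also have "\<dots> = - (6 * x + 5) * t / (32 * (2 * x + 1) * (x + 1) ^ 2) * B"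
        unfolding sq args using nz by (simp add: divide_simps) (simp add: power2_eq_square algebra_simps)
      finally show ?thesis .
    qed
    have hD: "h (2 * n + 2) (Suc n) = - t / (8 * (x + 1) ^ 2) * D"
    proof -
      have "h (2 * n + 2) (Suc n) = (-1) ^ n * ((-1) ^ n * (- ((half (Suc n) + real (2 * n + 2)) / (2 * real (2 * n + 2) ^ 2 * half (Suc n)))
          * (t * ((2 * x + 3) / (6 * x + 7))) * D))"
        unfolding h_def k2 D_def by simp
      also have "\<dots> = - t / (8 * (x + 1) ^ 2) * D"
        unfolding sq args two using nz by (simp add: divide_simps) (simp add: power2_eq_square algebra_simps)
      finally show ?thesis .
    qed
    have idx: "2 * Suc n - 2 = 2 * n" "2 * Suc n - 1 = 2 * n + 1" "2 * Suc n = 2 * n + 2"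
      "real (Suc n) - 1 / 2 = half n" "real (Suc n) = x + 1"
      by (simp_all add: x_def)
    have V: "V (2 * n + 1) (x + 1 + 1 / 2) = B" "V (2 * n + 2) (x + 1 + 1 / 2) = D"
      by (simp_all add: B_def D_def x_def add_ac)
    show "32 * (f (2 * n) n + h (2 * n + 1) (Suc n) + h (2 * n + 2) (Suc n)) =
       (\<lambda>k. inv_binom k / ((2 * real k - 1) * real k ^ 2) *
            (6 * (6 * real k - 1) * W (2 * k - 2) (real k - 1 / 2)
             - (6 * real k - 1) * V (2 * k - 1) (real k + 1 / 2)
             - 4 * (2 * real k - 1) * V (2 * k) (real k + 1 / 2))) (Suc n)"
      unfolding fA hB hD idx(1,2,4) unfolding idx(3,5) V A_def[symmetric] t_def[symmetric]
      using nz by (simp add: divide_simps) (simp add: algebra_simps)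
  qed
  finally show ?thesis
    by (simp add: sums_from_1_def f_def)
qed

section \<open>Weights from the poles of the kernel\<close>

definition pole_sum :: "nat \<Rightarrow> real \<Rightarrow> real" where
  "pole_sum N s = (\<Sum>i=1..N. 1 / (s - real i))"

lemma pole_sum_Suc: "pole_sum (Suc N) s = pole_sum N s + 1 / (s - real (Suc N))"
  by (simp add: pole_sum_def)

lemma pole_sum_0 [simp]: "pole_sum 0 s = 0"
  by (simp add: pole_sum_def)

lemma pole_sum_shift: "pole_sum N (s + 1) = pole_sum N s + 1 / s - 1 / (s - real N)"
  by (induction N) (simp_all add: pole_sum_Suc)

lemma abs_pole_sum_le:
  assumes "\<And>i::nat. \<bar>s - real i\<bar> \<ge> 1 / 2"
  shows "\<bar>pole_sum N s\<bar> \<le> 2 * real N"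
proof -
  have "\<bar>1 / (s - real i)\<bar> \<le> 2" for i
    using assms[of i] by (simp add: divide_simps)
  then have "(\<Sum>i=1..N. \<bar>1 / (s - real i)\<bar>) \<le> of_nat (card {1..N}) * 2"
    by (intro sum_bounded_above) auto
  then show ?thesis
    unfolding pole_sum_def using sum_abs[of "\<lambda>i. 1 / (s - real i)" "{1..N}"] by simp
qed

lemma dist_half_nat: "\<bar>half m - real i\<bar> \<ge> 1 / 2"
  by (cases "i \<le> m") auto

lemma harm_le: "harm N \<le> real N"
proof -
  have "harm N \<le> (\<Sum>k=1..N. 1 :: real)"
    unfolding harm_def by (intro sum_mono) (auto simp: field_simps)
  then show ?thesis by simp
qed

text \<open>
  These weights are a logarithmic derivative. For all \<open>y\<close> and \<open>z\<close>, the functions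
  \<open>C\<^sub>N / ((s + y) \<dots> (s + y + N) * (s - z) \<dots> (s - z - N))\<close> with
  \<open>C\<^sub>N = (-1)^N * N! * \<Prod>j=1..N. (j + (y + z) / 2)\<close> satisfy a two-row relation of the same kind, and at
  \<open>y = z = 0\<close> they equal \<open>kernel N s / s\<^sup>2\<close>. The logarithmic derivative in \<open>z\<close> at this point is
  \<open>pole_weight N s / 2\<close>, the one in \<open>y\<close> is \<open>pole_weight N (- s) / 2\<close>. Up to the same
  factor, \<open>pole_boundary\<close> is the logarithmic derivative of the boundary term in \<open>z\<close>.
\<close>

definition pole_weight :: "nat \<Rightarrow> real \<Rightarrow> real" where
  "pole_weight N s = harm N + 2 / s + 2 * pole_sum N s"

definition pole_boundary :: "nat \<Rightarrow> real \<Rightarrow> real" where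
  "pole_boundary N s = harm (N - 1) + 2 * pole_sum N s"

lemma pole_weight_equation:
  assumes "s \<notin> \<int>"
  shows "(real (Suc N) ^ 2 - s ^ 2) * pole_weight N s - real (Suc N) ^ 2 * pole_weight (Suc N) s =
      - s / 2 * ((s + real (Suc N)) * pole_boundary (Suc N) s
                 + (s - real (Suc N)) * pole_boundary (Suc N) (s + 1))"
proof -
  define q where "q = real (Suc N)"
  define A where "A = harm N + 2 * pole_sum (Suc N) s"
  have nz: "s \<noteq> 0" "s - q \<noteq> 0" "q > 0"
    using non_Int_cases(1)[OF assms, of 0] non_Int_cases(1)[OF assms, of "Suc N"] by (auto simp: q_def)
  have W: "pole_weight N s = A + 2 / s - 2 / (s - q)" "pole_weight (Suc N) s = A + 2 / s + 1 / q"
    by (simp_all add: pole_weight_def A_def q_def pole_sum_Suc harm_Suc inverse_eq_divide)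
  have V: "pole_boundary (Suc N) s = A" "pole_boundary (Suc N) (s + 1) = A + 2 / s - 2 / (s - q)"
    by (simp_all add: pole_boundary_def A_def q_def pole_sum_shift)
  have "(q ^ 2 - s ^ 2) * (2 / (s - q)) = - 2 * (s + q)"
    using nz by (simp add: field_simps power2_eq_square)
  then have "(q ^ 2 - s ^ 2) * (A + 2 / s - 2 / (s - q)) = (q ^ 2 - s ^ 2) * (A + 2 / s) + 2 * (s + q)"
    by (simp add: right_diff_distrib)
  moreover have "(q ^ 2 - s ^ 2) * (A + 2 / s) + 2 * (s + q) - q ^ 2 * (A + 2 / s + 1 / q) = q - s ^ 2 * A"
    using nz by (simp add: field_simps power2_eq_square)
  moreover have "- s / 2 * ((s + q) * A + (s - q) * (A + 2 / s - 2 / (s - q))) = q - s ^ 2 * A"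
    using nz by (simp add: field_simps power2_eq_square)
  ultimately show ?thesis
    unfolding W V q_def[symmetric] by simp
qed

lemma pole_weight_bounds:
  assumes "\<And>i::nat. \<bar>s - real i\<bar> \<ge> 1 / 2"
  shows "\<bar>pole_weight N s\<bar> \<le> 8 * (real N + 1)" "\<bar>pole_boundary (Suc N) s\<bar> \<le> 8 * (real N + 1)"
proof -
  have s: "\<bar>2 / s\<bar> \<le> 4"
    using assms[of 0] by (simp add: divide_simps)
  have triangle: "\<bar>h + a + 2 * p\<bar> \<le> 8 * (n + 1)"
    if "\<bar>a\<bar> \<le> 4" "0 \<le> h" "h \<le> n" "\<bar>p\<bar> \<le> 2 * (n + 1)" for a h p n :: real
    using that by (auto simp: abs_le_iff)
  have h: "0 \<le> (harm N :: real)" "harm N \<le> real N"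
    by (simp_all add: harm_nonneg harm_le)
  have p: "\<bar>pole_sum N s\<bar> \<le> 2 * (real N + 1)" "\<bar>pole_sum (Suc N) s\<bar> \<le> 2 * (real N + 1)"
    using abs_pole_sum_le[OF assms, of N] abs_pole_sum_le[OF assms, of "Suc N"] by simp_all
  show "\<bar>pole_weight N s\<bar> \<le> 8 * (real N + 1)"
    unfolding pole_weight_def by (rule triangle[OF s h p(1)])
  show "\<bar>pole_boundary (Suc N) s\<bar> \<le> 8 * (real N + 1)"
    using triangle[OF _ h p(2), of 0] by (simp add: pole_boundary_def)
qed

text \<open>
  The points \<open>1, \<dots>, 2 n\<close> lie symmetrically around \<open>n + 1/2\<close>, so the summands cancel in pairs.
\<close>

lemma pole_sum_half: "pole_sum (2 * n) (half n) = 0"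
proof -
  have "pole_sum (2 * n) (half n) = (\<Sum>i=1..2 * n. 1 / (half n - real (2 * n + 1 - i)))"
    unfolding pole_sum_def by (subst sum.atLeastAtMost_rev) (simp add: add.commute)
  also have "\<dots> = (\<Sum>i=1..2 * n. - (1 / (half n - real i)))"
  proof (rule sum.cong)
    fix i assume "i \<in> {1..2 * n}"
    then have "half n - real (2 * n + 1 - i) = - (half n - real i)"
      by (simp add: of_nat_diff)
    then show "1 / (half n - real (2 * n + 1 - i)) = - (1 / (half n - real i))"
      by (simp only: divide_minus_right)
  qed simp
  also have "\<dots> = - pole_sum (2 * n) (half n)"
    by (simp add: pole_sum_def sum_negf)
  finally show ?thesis by simp
qed

text \<open>
  At the reflected points \<open>- s\<close> the poles no longer cancel in pairs, and sums of reciprocals of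
  half-integers remain. They are twice the sums of \<open>1 / (2 i - 1)\<close>.
\<close>

definition odd_harm :: "nat \<Rightarrow> real" where
  "odd_harm n = (\<Sum>i=1..n. 1 / (real i - 1 / 2))"

lemma odd_harm_Suc: "odd_harm (Suc n) = odd_harm n + 1 / (real n + 1 / 2)"
  by (simp add: odd_harm_def)

lemma odd_harm_eq: "odd_harm n = 2 * harm (2 * n) - harm n"
proof (induction n)
  case (Suc n)
  have "harm (2 * Suc n) = harm (2 * n) + 1 / (2 * real n + 1) + 1 / (2 * real n + 2)"
    by (simp add: harm_Suc inverse_eq_divide add_ac)
  moreover have "1 / (real n + 1 / 2) = 2 * (1 / (2 * real n + 1))"
    "1 / (real n + 1) = 2 * (1 / (2 * real n + 2))"
    by (simp_all add: divide_simps)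
  moreover have "harm (Suc n) = harm n + 1 / (real n + 1)"
    by (simp add: harm_Suc inverse_eq_divide add_ac)
  ultimately show ?case
    unfolding odd_harm_Suc using Suc by simp
qed (simp add: odd_harm_def harm_def)

lemma pole_sum_reflected: "pole_sum N (1 / 2 - real n) = odd_harm n - odd_harm (n + N)"
proof (induction N)
  case (Suc N)
  have "1 / 2 - real n - real (Suc N) = - (real (n + N) + 1 / 2)" by simp
  then have "1 / (1 / 2 - real n - real (Suc N)) = - (1 / (real (n + N) + 1 / 2))"
    by (simp only: divide_minus_right)
  then show ?case
    unfolding pole_sum_Suc Suc add_Suc_right odd_harm_Suc by simp
qed simp

section \<open>The series\<close>

lemma sums_from_1_cong:
  assumes "a sums_from_1 x" "\<And>k. k \<ge> 1 \<Longrightarrow> a k = b k" "x = y"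
  shows "b sums_from_1 y"
  using assms by (simp add: sums_from_1_def)

lemma harm_pred:
  assumes "k \<ge> 1"
  shows "harm k = harm (k - 1) + 1 / real k"
  using assms by (cases k) (simp_all add: harm_Suc inverse_eq_divide)

lemma series_harm:
  "(\<lambda>k. prefactor k * ((22 * real k - 1) * harm (2 * k - 1) + 15 * ((6 * real k - 1) / (2 * real k - 1))))
     sums_from_1 (16 * pi ^ 3)"
proof (rule sums_from_1_cong)
  show "(\<lambda>k. prefactor k *
            (6 * (6 * real k - 1) * pole_weight (2 * k - 2) (real k - 1 / 2)
             - (6 * real k - 1) * pole_boundary (2 * k - 1) (real k + 1 / 2)
             - 4 * (2 * real k - 1) * pole_boundary (2 * k) (real k + 1 / 2)))
         sums_from_1 (32 * (\<Sum>m. (-1) ^ m * pole_weight 0 (half m) / half m ^ 2))"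
    by (rule weighted_acceleration pole_weight_equation pole_weight_bounds dist_half_nat | assumption)+
  have S: "summable (\<lambda>m. (-1) ^ m / half m ^ 3)"
    by (rule summable_alternating_half) simp
  have "(-1) ^ m * pole_weight 0 (half m) / half m ^ 2 = 2 * ((-1) ^ m / half m ^ 3)" for m
    by (simp add: pole_weight_def harm_def eval_nat_numeral)
  then have "(\<Sum>m. (-1) ^ m * pole_weight 0 (half m) / half m ^ 2) = 2 * (\<Sum>m. (-1) ^ m / half m ^ 3)"
    by (simp only: suminf_mult[OF S])
  then show "32 * (\<Sum>m. (-1) ^ m * pole_weight 0 (half m) / half m ^ 2) = 16 * pi ^ 3"
    using suminf_alternating_half[of 3] by (simp add: dirichlet_beta_3)
next
  fix k :: nat assume k: "k \<ge> 1"
  define r where "r = 2 * real k - 1"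
  define H where "H = (harm (2 * k - 1) :: real)"
  have r: "r > 0" and k_eq: "real k = (r + 1) / 2" using k by (simp_all add: r_def)
  have h: "harm (2 * k - 2) = H - 1 / r"
    using harm_pred[of "2 * k - 1"] k by (simp add: H_def r_def of_nat_diff numeral_2_eq_2)
  have P2: "pole_sum (2 * k) (real k + 1 / 2) = 0"
    by (rule pole_sum_half)
  have P1: "pole_sum (2 * k - 1) (real k + 1 / 2) = 2 / r"
  proof -
    have "2 * k = Suc (2 * k - 1)" using k by simp
    with P2 have "pole_sum (2 * k - 1) (real k + 1 / 2) + 1 / (real k + 1 / 2 - real (2 * k)) = 0"
      by (metis pole_sum_Suc)
    moreover have "real k + 1 / 2 - real (2 * k) = - (r / 2)" by (simp add: r_def field_simps)
    ultimately show ?thesis by simp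
  qed
  have P0: "pole_sum (2 * k - 2) (real k - 1 / 2) = 0"
  proof -
    have "2 * k - 2 = 2 * (k - 1)" "real k - 1 / 2 = half (k - 1)"
      using k by (simp_all add: of_nat_diff)
    then show ?thesis by (simp only: pole_sum_half)
  qed
  have "2 / (real k - 1 / 2) = 4 / r"
    using r by (simp add: k_eq field_simps)
  then have W: "pole_weight (2 * k - 2) (real k - 1 / 2) = H + 3 / r"
    unfolding pole_weight_def P0 h by simp
  have V: "pole_boundary (2 * k - 1) (real k + 1 / 2) = H + 3 / r"
    "pole_boundary (2 * k) (real k + 1 / 2) = H"
    unfolding pole_boundary_def P1 P2 using h by (simp_all add: H_def numeral_2_eq_2)
  have "6 * (6 * real k - 1) * (H + 3 / r) - (6 * real k - 1) * (H + 3 / r) - 4 * r * H =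
      (22 * real k - 1) * H + 15 * ((6 * real k - 1) / r)"
    using r by (simp add: k_eq field_simps)
  then show "prefactor k * (6 * (6 * real k - 1) * pole_weight (2 * k - 2) (real k - 1 / 2)
             - (6 * real k - 1) * pole_boundary (2 * k - 1) (real k + 1 / 2)
             - 4 * (2 * real k - 1) * pole_boundary (2 * k) (real k + 1 / 2)) =
      prefactor k * ((22 * real k - 1) * harm (2 * k - 1) + 15 * ((6 * real k - 1) / (2 * real k - 1)))"
    unfolding W V r_def[symmetric] H_def[symmetric] by (simp only:)
qed

text \<open>
  The substitution \<open>s \<mapsto> - s\<close> preserves the weight equation if the boundary weights at \<open>s\<close> and \<open>s + 1\<close> are
  exchanged, that is, if \<open>V s\<close> becomes \<open>V (1 - s)\<close>. It corresponds to the derivative in \<open>y\<close> instead of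
  \<open>z\<close>, and it changes the sign of the initial weight \<open>2 / s\<close>, hence of the sum.
\<close>

lemma series_odd_harm:
  "(\<lambda>k. prefactor k * ((22 * real k - 1) * (harm (2 * k - 1) - 2 * (odd_harm (3 * k) - odd_harm k))
         + (1 - 86 * real k) / (2 * real k - 1)))
     sums_from_1 (- 16 * pi ^ 3)"
proof (rule sums_from_1_cong)
  show "(\<lambda>k. prefactor k *
            (6 * (6 * real k - 1) * pole_weight (2 * k - 2) (- (real k - 1 / 2))
             - (6 * real k - 1) * pole_boundary (2 * k - 1) (1 - (real k + 1 / 2))
             - 4 * (2 * real k - 1) * pole_boundary (2 * k) (1 - (real k + 1 / 2))))
         sums_from_1 (32 * (\<Sum>m. (-1) ^ m * pole_weight 0 (- half m) / half m ^ 2))"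
  proof (rule weighted_acceleration)
    fix N s assume "s \<notin> (\<int> :: real set)"
    then have "- s \<notin> \<int>" by simp
    from pole_weight_equation[OF this, of N]
    show "(real (Suc N) ^ 2 - s ^ 2) * pole_weight N (- s) - real (Suc N) ^ 2 * pole_weight (Suc N) (- s) =
      - s / 2 * ((s + real (Suc N)) * pole_boundary (Suc N) (1 - s)
                 + (s - real (Suc N)) * pole_boundary (Suc N) (1 - (s + 1)))"
      by (simp add: algebra_simps)
  next
    fix N m
    have "\<bar>- half m - real i\<bar> \<ge> 1 / 2" for i by simp
    then show "\<bar>pole_weight N (- half m)\<bar> \<le> 8 * (real N + 1)" by (rule pole_weight_bounds)
    have "\<bar>1 - half m - real i\<bar> \<ge> 1 / 2" for i by (cases "m + i = 0") auto
    then show "\<bar>pole_boundary (Suc N) (1 - half m)\<bar> \<le> 8 * (real N + 1)" by (rule pole_weight_bounds)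
  qed
  have S: "summable (\<lambda>m. (-1) ^ m / half m ^ 3)"
    by (rule summable_alternating_half) simp
  have "(-1) ^ m * pole_weight 0 (- half m) / half m ^ 2 = - 2 * ((-1) ^ m / half m ^ 3)" for m
  proof -
    have "pole_weight 0 (- half m) = - (2 / half m)"
      unfolding pole_weight_def by (simp add: harm_def del: minus_add_distrib)
    then show ?thesis by (simp add: eval_nat_numeral)
  qed
  then have "(\<Sum>m. (-1) ^ m * pole_weight 0 (- half m) / half m ^ 2) = - 2 * (\<Sum>m. (-1) ^ m / half m ^ 3)"
    by (simp only: suminf_mult[OF S])
  then show "32 * (\<Sum>m. (-1) ^ m * pole_weight 0 (- half m) / half m ^ 2) = - 16 * pi ^ 3"
    using suminf_alternating_half[of 3] by (simp add: dirichlet_beta_3)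
next
  fix k :: nat assume k: "k \<ge> 1"
  define r where "r = 2 * real k - 1"
  define H where "H = (harm (2 * k - 1) :: real)"
  define D where "D = odd_harm (3 * k) - odd_harm k"
  have r: "r > 0" and k_eq: "real k = (r + 1) / 2" using k by (simp_all add: r_def)
  have h: "harm (2 * k - 2) = H - 1 / r"
    using harm_pred[of "2 * k - 1"] k by (simp add: H_def r_def of_nat_diff numeral_2_eq_2)
  have P2: "pole_sum (2 * k) (1 / 2 - real k) = - D"
    unfolding pole_sum_reflected D_def by (simp add: algebra_simps)
  have idx: "2 * k = Suc (2 * k - 1)" "2 * k - 1 = Suc (2 * k - 2)" using k by simp_all
  have "pole_sum (2 * k) (1 / 2 - real k) =
      pole_sum (2 * k - 1) (1 / 2 - real k) + 1 / (1 / 2 - real k - real (2 * k))"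
    by (metis idx(1) pole_sum_Suc)
  moreover have "1 / (1 / 2 - real k - real (2 * k)) = - (2 / (6 * real k - 1))"
    using k by (simp add: divide_simps)
  ultimately have P1: "pole_sum (2 * k - 1) (1 / 2 - real k) = - D + 2 / (6 * real k - 1)"
    using P2 by simp
  have "pole_sum (2 * k - 1) (1 / 2 - real k) =
      pole_sum (2 * k - 2) (1 / 2 - real k) + 1 / (1 / 2 - real k - real (2 * k - 1))"
    by (metis idx(2) pole_sum_Suc)
  moreover have "1 / (1 / 2 - real k - real (2 * k - 1)) = - (2 / (3 * r))"
    using k by (simp add: r_def of_nat_diff divide_simps)
  ultimately have P0: "pole_sum (2 * k - 2) (1 / 2 - real k) = - D + 2 / (6 * real k - 1) + 2 / (3 * r)"
    using P1 by simp
  have arg: "- (real k - 1 / 2) = 1 / 2 - real k" "1 - (real k + 1 / 2) = 1 / 2 - real k" by simp_all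
  have "2 / (1 / 2 - real k) = - (4 / r)"
    using r by (simp add: k_eq field_simps)
  then have W: "pole_weight (2 * k - 2) (1 / 2 - real k) =
      H - 5 / r - 2 * D + 4 / (6 * real k - 1) + 4 / (3 * r)"
    unfolding pole_weight_def P0 h by simp
  have V: "pole_boundary (2 * k - 1) (1 / 2 - real k) = H - 1 / r - 2 * D + 4 / (6 * real k - 1)"
    "pole_boundary (2 * k) (1 / 2 - real k) = H - 2 * D"
    unfolding pole_boundary_def P1 P2 using h by (simp_all add: H_def numeral_2_eq_2)
  have p: "6 * real k - 1 = 3 * r + 2" "22 * real k - 1 = 11 * r + 10" "1 - 86 * real k = - 43 * r - 42"
    by (simp_all add: k_eq field_simps)
  have "6 * (3 * r + 2) * (H - 5 / r - 2 * D + 4 / (3 * r + 2) + 4 / (3 * r))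
        - (3 * r + 2) * (H - 1 / r - 2 * D + 4 / (3 * r + 2)) - 4 * r * (H - 2 * D) =
      (11 * r + 10) * (H - 2 * D) + (- 43 * r - 42) / r"
    using r by (simp add: divide_simps) (simp add: algebra_simps)
  then show "prefactor k * (6 * (6 * real k - 1) * pole_weight (2 * k - 2) (- (real k - 1 / 2))
             - (6 * real k - 1) * pole_boundary (2 * k - 1) (1 - (real k + 1 / 2))
             - 4 * (2 * real k - 1) * pole_boundary (2 * k) (1 - (real k + 1 / 2))) =
      prefactor k * ((22 * real k - 1) * (harm (2 * k - 1) - 2 * (odd_harm (3 * k) - odd_harm k))
         + (1 - 86 * real k) / (2 * real k - 1))"
    unfolding arg W V r_def[symmetric] H_def[symmetric] D_def[symmetric] p by (simp only:)
qed

text \<open>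
  The weight \<open>1 / s\<^sup>2 - gen_harm 2 N\<close> is the coefficient of \<open>x\<^sup>2\<close>, relative to the kernel, in
  \<open>(\<Prod>i=1..N. 1 - x\<^sup>2 / i\<^sup>2) / (1 - x\<^sup>2 / s\<^sup>2)\<close>. The corresponding row differences are the old ones times
  \<open>\<Prod>i=1..N-1. 1 - x\<^sup>2 / i\<^sup>2\<close>, which explains the boundary weight.
\<close>

lemma series_harm_2:
  "(\<lambda>k. prefactor k * - ((22 * real k - 1) * gen_harm 2 (2 * k - 1) - 29 * ((6 * real k - 1) / (2 * real k - 1) ^ 2)))
     sums_from_1 (512 * dirichlet_beta 4)"
proof (rule sums_from_1_cong)
  have gen_harm_Suc: "gen_harm 2 (Suc N) = gen_harm 2 N + 1 / real (Suc N) ^ 2" for N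
    by (simp add: gen_harm_def)
  have bounds: "0 \<le> gen_harm 2 N" "gen_harm 2 N \<le> real N" for N
  proof -
    show "0 \<le> gen_harm 2 N" by (simp add: gen_harm_def sum_nonneg)
    have "gen_harm 2 N \<le> (\<Sum>j=1..N. 1)"
      unfolding gen_harm_def by (intro sum_mono) (simp add: divide_simps)
    then show "gen_harm 2 N \<le> real N" by simp
  qed
  have triangle: "\<bar>a - g\<bar> \<le> 4 * (n + 1)" if "0 \<le> a" "a \<le> 4" "0 \<le> g" "g \<le> n" for a g n :: real
    using that by (auto simp: abs_le_iff)
  show "(\<lambda>k. prefactor k *
            (6 * (6 * real k - 1) * (1 / (real k - 1 / 2) ^ 2 - gen_harm 2 (2 * k - 2))
             - (6 * real k - 1) * - gen_harm 2 (2 * k - 1 - 1)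
             - 4 * (2 * real k - 1) * - gen_harm 2 (2 * k - 1)))
         sums_from_1 (32 * (\<Sum>m. (-1) ^ m * (1 / half m ^ 2 - gen_harm 2 0) / half m ^ 2))"
  proof (rule weighted_acceleration[where W = "\<lambda>N s. 1 / s ^ 2 - gen_harm 2 N"
          and V = "\<lambda>N s. - gen_harm 2 (N - 1)"])
    fix N s assume "s \<notin> (\<int> :: real set)"
    then have "s \<noteq> 0" by auto
    define q where "q = real (Suc N)"
    have "q > 0" by (simp add: q_def)
    with \<open>s \<noteq> 0\<close>
    show "(real (Suc N) ^ 2 - s ^ 2) * (1 / s ^ 2 - gen_harm 2 N)
          - real (Suc N) ^ 2 * (1 / s ^ 2 - gen_harm 2 (Suc N)) =
        - s / 2 * ((s + real (Suc N)) * - gen_harm 2 (Suc N - 1) + (s - real (Suc N)) * - gen_harm 2 (Suc N - 1))"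
      unfolding gen_harm_Suc q_def[symmetric] diff_Suc_1
      by (simp add: divide_simps) (simp add: power2_eq_square algebra_simps)
  next
    fix N m
    have "1 / 4 \<le> half m ^ 2"
      using power_mono[of "1 / 2" "half m" 2] by (simp add: power2_eq_square)
    then have "0 \<le> 1 / half m ^ 2" "1 / half m ^ 2 \<le> 4"
      by (simp_all add: divide_simps)
    then show "\<bar>1 / half m ^ 2 - gen_harm 2 N\<bar> \<le> 4 * (real N + 1)"
      by (intro triangle bounds)
    show "\<bar>- gen_harm 2 (Suc N - 1)\<bar> \<le> 4 * (real N + 1)"
      using bounds[of N] by simp
  qed
  have "(-1) ^ m * (1 / half m ^ 2 - gen_harm 2 0) / half m ^ 2 = (-1) ^ m / half m ^ 4" for m
    by (simp add: gen_harm_def power2_eq_square power4_eq_xxxx mult_ac)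
  then show "32 * (\<Sum>m. (-1) ^ m * (1 / half m ^ 2 - gen_harm 2 0) / half m ^ 2) = 512 * dirichlet_beta 4"
    using suminf_alternating_half[of 4] by simp
  fix k :: nat assume k: "k \<ge> 1"
  define r where "r = 2 * real k - 1"
  define G where "G = gen_harm 2 (2 * k - 1)"
  have r: "r > 0" and k_eq: "real k = (r + 1) / 2" using k by (simp_all add: r_def)
  have "2 * k - 1 = Suc (2 * k - 2)" "real (Suc (2 * k - 2)) = r" using k by (simp_all add: r_def of_nat_diff)
  then have g: "gen_harm 2 (2 * k - 2) = G - 1 / r ^ 2"
    unfolding G_def using gen_harm_Suc[of "2 * k - 2"] by simp
  have g': "gen_harm 2 (2 * k - 1 - 1) = G - 1 / r ^ 2"
    using g by (simp add: numeral_2_eq_2)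
  have sq: "1 / (real k - 1 / 2) ^ 2 = 4 / r ^ 2"
    using r by (simp add: k_eq power2_eq_square field_simps)
  have "6 * (6 * real k - 1) * (4 / r ^ 2 - (G - 1 / r ^ 2)) - (6 * real k - 1) * - (G - 1 / r ^ 2) - 4 * r * - G =
      - ((22 * real k - 1) * G - 29 * ((6 * real k - 1) / r ^ 2))"
    using r by (simp add: k_eq divide_simps) (simp add: algebra_simps)
  then show "prefactor k * (6 * (6 * real k - 1) * (1 / (real k - 1 / 2) ^ 2 - gen_harm 2 (2 * k - 2))
             - (6 * real k - 1) * - gen_harm 2 (2 * k - 1 - 1)
             - 4 * (2 * real k - 1) * - gen_harm 2 (2 * k - 1)) =
      prefactor k * - ((22 * real k - 1) * gen_harm 2 (2 * k - 1) - 29 * ((6 * real k - 1) / (2 * real k - 1) ^ 2))"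
    unfolding sq g g' r_def[symmetric] G_def[symmetric] by (simp only:)
qed

lemma odd_harm_triple:
  assumes "k \<ge> 1"
  shows "odd_harm (3 * k) - odd_harm k =
     2 * harm (6 * k - 1) - harm (3 * k - 1) + harm (k - 1) - 2 * harm (2 * k - 1)"
proof -
  have "harm (3 * k) = harm (3 * k - 1) + 1 / (3 * real k)" "harm (2 * k) = harm (2 * k - 1) + 1 / (2 * real k)"
    "harm (6 * k) = harm (6 * k - 1) + 1 / (6 * real k)" "harm k = harm (k - 1) + 1 / real k"
    using assms by (subst harm_pred; simp)+
  then show ?thesis by (simp add: odd_harm_eq)
qed

lemma sums_from_1_lincomb:
  assumes "a sums_from_1 x" "b sums_from_1 y"
  shows "(\<lambda>k. c * a k + d * b k) sums_from_1 (c * x + d * y)"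
  using assms unfolding sums_from_1_def by (intro sums_add sums_mult)

theorem theorem1p9:
  shows "(\<lambda>k. 256 ^ k * ((22 * real k - 1) * harm (2*k - 1)
                 + 15 * ((6 * real k - 1) / (2 * real k - 1)))
              / ((2 * real k - 1) * real k ^ 2 * real ((3*k) choose k) * real ((6*k) choose (3*k))))
           sums_from_1 (16 * pi ^ 3)
    \<and> (\<lambda>k. 256 ^ k * ((22 * real k - 1) * (2 * harm (6*k - 1) - harm (3*k - 1) + harm (k - 1))
                 + (268 * real k - 38) / (2 * real k - 1))
              / ((2 * real k - 1) * real k ^ 2 * real ((3*k) choose k) * real ((6*k) choose (3*k))))
           sums_from_1 (48 * pi ^ 3)
    \<and> (\<lambda>k. 256 ^ k * ((22 * real k - 1) * calH k - 50)
              / ((2 * real k - 1) * real k ^ 2 * real ((3*k) choose k) * real ((6*k) choose (3*k))))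
           sums_from_1 (- 16 * pi ^ 3)
    \<and> (\<lambda>k. 256 ^ k * ((22 * real k - 1) * gen_harm 2 (2*k - 1)
                 - 29 * ((6 * real k - 1) / (2 * real k - 1) ^ 2))
              / ((2 * real k - 1) * real k ^ 2 * real ((3*k) choose k) * real ((6*k) choose (3*k))))
           sums_from_1 (- 512 * dirichlet_beta 4)"
proof -
  have scale: "256 ^ k * c / ((2 * real k - 1) * real k ^ 2 * real ((3*k) choose k) * real ((6*k) choose (3*k)))
      = prefactor k * c" for k c
    by (simp add: inv_binom_def)
  define P where "P k = prefactor k * ((22 * real k - 1) * (2 * harm (6*k - 1) - harm (3*k - 1) + harm (k - 1))
                 + (268 * real k - 38) / (2 * real k - 1))" for k
  \<comment> \<open>By \<open>odd_harm_triple\<close>, the series \<open>series_odd_harm\<close> is five times the first series minus twice \<open>P\<close>.\<close>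
  have second: "P sums_from_1 (48 * pi ^ 3)"
  proof (rule sums_from_1_cong[OF sums_from_1_lincomb[OF series_harm series_odd_harm, of "5 / 2" "- 1 / 2"]])
    fix k :: nat assume k: "k \<ge> 1"
    define r where "r = 2 * real k - 1"
    define H where "H = (harm (2 * k - 1) :: real)"
    define E where "E = (2 * harm (6*k - 1) - harm (3*k - 1) + harm (k - 1) :: real)"
    have "r \<noteq> 0" and k_eq: "real k = (r + 1) / 2" using k by (simp_all add: r_def)
    have "5 / 2 * (b * ((22 * real k - 1) * H + 15 * ((6 * real k - 1) / r)))
        + - 1 / 2 * (b * ((22 * real k - 1) * (H - 2 * (E - 2 * H)) + (1 - 86 * real k) / r)) =
        b * ((22 * real k - 1) * E + (268 * real k - 38) / r)" for b
      using \<open>r \<noteq> 0\<close> by (simp add: k_eq divide_simps) (simp add: algebra_simps)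
    then show "5 / 2 * (prefactor k * ((22 * real k - 1) * harm (2 * k - 1) + 15 * ((6 * real k - 1) / (2 * real k - 1))))
        + - 1 / 2 * (prefactor k * ((22 * real k - 1) * (harm (2 * k - 1) - 2 * (odd_harm (3 * k) - odd_harm k))
            + (1 - 86 * real k) / (2 * real k - 1))) = P k"
      unfolding P_def odd_harm_triple[OF k] r_def[symmetric] H_def[symmetric] E_def[symmetric] .
  qed simp
  have third: "(\<lambda>k. prefactor k * ((22 * real k - 1) * calH k - 50)) sums_from_1 (- 16 * pi ^ 3)"
  proof (rule sums_from_1_cong[OF sums_from_1_lincomb[OF second series_harm, of 5 "-16"]])
    fix k :: nat assume k: "k \<ge> 1"
    define r where "r = 2 * real k - 1"
    define H where "H = (harm (2 * k - 1) :: real)"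
    define E where "E = (2 * harm (6*k - 1) - harm (3*k - 1) + harm (k - 1) :: real)"
    have "r \<noteq> 0" and k_eq: "real k = (r + 1) / 2" using k by (simp_all add: r_def)
    have calH: "calH k = 5 * E - 16 * H"
      by (simp add: calH_def E_def H_def)
    have "5 * (b * ((22 * real k - 1) * E + (268 * real k - 38) / r))
        + - 16 * (b * ((22 * real k - 1) * H + 15 * ((6 * real k - 1) / r))) =
        b * ((22 * real k - 1) * (5 * E - 16 * H) - 50)" for b
      using \<open>r \<noteq> 0\<close> by (simp add: k_eq divide_simps) (simp add: algebra_simps)
    then show "5 * P k + - 16 * (prefactor k * ((22 * real k - 1) * harm (2 * k - 1)
          + 15 * ((6 * real k - 1) / (2 * real k - 1)))) = prefactor k * ((22 * real k - 1) * calH k - 50)"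
      unfolding P_def calH r_def[symmetric] H_def[symmetric] E_def[symmetric] .
  qed simp
  have fourth: "(\<lambda>k. prefactor k * ((22 * real k - 1) * gen_harm 2 (2 * k - 1)
        - 29 * ((6 * real k - 1) / (2 * real k - 1) ^ 2))) sums_from_1 (- 512 * dirichlet_beta 4)"
    using sums_minus[OF series_harm_2[unfolded sums_from_1_def]]
    by (simp only: sums_from_1_def mult_minus_right mult_minus_left minus_minus)
  show ?thesis
    unfolding scale using series_harm second[unfolded P_def] third fourth by blast
qed

end
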